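(* Let $k=\mathbb{F}_3$, let $O_7(k)$ be the group of $7\times7$ matrices over $k$ orthogonal for the bilinear form $\langle x,y\rangle=x_1y_7+x_2y_6+\dots+x_7y_1$ on $k^7$, and let \[ A=\begin{pmatrix} 0&0&1&0&0&1&0\\ 1&0&0&0&0&0&1\\ 0&1&0&0&0&0&0\\ 0&0&0&0&0&0&0\\ 0&1&0&0&0&0&1\\ 0&0&1&0&1&0&0\\ 0&0&0&0&0&1&0 \end{pmatrix}. \] Then there is no $g\in O_7(k)$ such that the matrix $M=g^{-1}Ag$ satisfies $M_{ij}=0$ for all $(i,j)$ in \[ \{(3,1),(4,1),(5,1),(5,2),(6,1),(6,2),(6,3),(7,1),(7,2),(7,3),(7,4),(7,5)\} \] (with the remaining entries arbitrary).
   Context: $M_{ij}$ denotes the entry in row $i$ and column $j$. *)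

theory Defs
  imports "HOL-Analysis.Analysis" "HOL-Library.Numeral_Type"
begin

text \<open>The field F_3 is the type 3 (integers mod 3); k^7 is 3^7, indexed by the type 7.
 Paper index a in {1..7} corresponds to the element ix a = of_nat (a - 1) of type 7.\<close>

definition ix :: "nat \<Rightarrow> 7" where
  "ix a = of_nat (a - 1)"

definition bform :: "3^7 \<Rightarrow> 3^7 \<Rightarrow> 3" where
  "bform x y = (\<Sum>a = 1..7. x $ ix a * y $ ix (8 - a))"

definition O7 :: "(3^7^7) set" where
  "O7 = {g. \<forall>x y. bform (g *v x) (g *v y) = bform x y}"

definition A_nonzero :: "(nat \<times> nat) set" where
  "A_nonzero = {(1,3),(1,6),(2,1),(2,7),(3,2),(5,2),(5,7),(6,3),(6,5),(7,6)}"

definition matA :: "3^7^7" where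
  "matA = (\<chi> i j. if (\<exists>a b. (a, b) \<in> A_nonzero \<and> i = ix a \<and> j = ix b) then 1 else 0)"

definition zero_pos :: "(nat \<times> nat) set" where
  "zero_pos = {(3,1),(4,1),(5,1),(5,2),(6,1),(6,2),(6,3),(7,1),(7,2),(7,3),(7,4),(7,5)}"

end

(*
  Let g be such a matrix and b_0, ..., b_6 its columns (indices shifted down by one):
  orthogonality makes them a hyperbolic basis, bform (b c) (b d) = 1 if c + d = 6 and 0 otherwise,
  and the prescribed zeros say that A b_0 lies in <b_0, b_1> and A b_1 in <b_0, ..., b_3>.
  Hence x = b_0 satisfies <x,x> = <x,Ax> = <Ax,Ax> = <Ax,A^2 x> = 0, and y = b_2 is isotropic and
  orthogonal to x, Ax and A^2 x.  An exhaustive search over k^7 shows that the nonzero solutions x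
  form a single orbit of the centraliser of A in O_7(k), so we may assume x = e_0.  Then
  y_6 = y_5 = 0 and y_4 = -y_2, and isotropy of y reads y_3^2 = 2 y_2^2, which forces
  y_2 = y_3 = 0 because 2 is not a square mod 3.  Thus y lies in <x, Ax>, which is contained in
  <b_0, b_1>, contradicting <b_2, b_4> = 1.
*)

theory Submission
  imports Defs
begin

lemma F3_cases:
  fixes x :: 3
  obtains "x = 0" | "x = 1" | "x = 2"
proof (cases x)
  case (of_int z)
  then have "z = 0 \<or> z = 1 \<or> z = 2" by auto
  with of_int that show ?thesis by fastforce
qed

lemma F3_table:
  "(1::3) + 2 = 0" "(2::3) + 1 = 0" "(2::3) + 2 = 1" "(2::3) * 2 = 1" "(4::3) = 1"
  "(0::3) \<noteq> 1" "(1::3) \<noteq> 0" "(0::3) \<noteq> 2" "(2::3) \<noteq> 0" "(1::3) \<noteq> 2" "(2::3) \<noteq> 1"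
  by simp_all

lemmas F3_arith = F3_table one_add_one [where 'a = 3]
  add_0_left add_0_right mult_zero_left mult_zero_right mult_1_left mult_1_right

lemma F3_multiples_of_3: "(3::3) = 0" "(6::3) = 0"
  by simp_all

lemma F3_two_nonsquare:
  fixes a b :: 3
  assumes "b * b = 2 * (a * a)"
  shows "a = 0" and "b = 0"
  using assms by (cases a rule: F3_cases; cases b rule: F3_cases; simp add: F3_table)+

lemma UNIV_7: "(UNIV :: 7 set) = {0, 1, 2, 3, 4, 5, 6}"
proof -
  have "i \<in> {0, 1, 2, 3, 4, 5, 6}" for i :: 7
  proof (cases i)
    case (of_int z)
    then have "z \<in> {0, 1, 2, 3, 4, 5, 6}" by auto
    with of_int show ?thesis by auto
  qed
  then show ?thesis by blast
qed

lemma all_7: "(\<forall>i::7. P i) \<longleftrightarrow> P 0 \<and> P 1 \<and> P 2 \<and> P 3 \<and> P 4 \<and> P 5 \<and> P 6"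
  by (metis UNIV_7 UNIV_I insertE empty_iff)

lemma sum_UNIV_7: "(\<Sum>i\<in>UNIV. f (i::7)) = f 0 + f 1 + f 2 + f 3 + f 4 + f 5 + (f 6 :: 'a::comm_monoid_add)"
  unfolding UNIV_7 by (simp add: add.assoc)

definition vec7 :: "'a \<Rightarrow> 'a \<Rightarrow> 'a \<Rightarrow> 'a \<Rightarrow> 'a \<Rightarrow> 'a \<Rightarrow> 'a \<Rightarrow> 'a^7" where
  "vec7 a0 a1 a2 a3 a4 a5 a6 = (\<chi> i. if i = 0 then a0 else if i = 1 then a1 else if i = 2 then a2
     else if i = 3 then a3 else if i = 4 then a4 else if i = 5 then a5 else a6)"

lemma vec7_nth [simp]:
  "vec7 a0 a1 a2 a3 a4 a5 a6 $ 0 = a0" "vec7 a0 a1 a2 a3 a4 a5 a6 $ 1 = a1"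
  "vec7 a0 a1 a2 a3 a4 a5 a6 $ 2 = a2" "vec7 a0 a1 a2 a3 a4 a5 a6 $ 3 = a3"
  "vec7 a0 a1 a2 a3 a4 a5 a6 $ 4 = a4" "vec7 a0 a1 a2 a3 a4 a5 a6 $ 5 = a5"
  "vec7 a0 a1 a2 a3 a4 a5 a6 $ 6 = a6"
  by (simp_all add: vec7_def)

lemma vec7_eq_iff: "x = vec7 a0 a1 a2 a3 a4 a5 a6 \<longleftrightarrow>
    x$0 = a0 \<and> x$1 = a1 \<and> x$2 = a2 \<and> x$3 = a3 \<and> x$4 = a4 \<and> x$5 = a5 \<and> x$6 = a6"
  by (simp add: vec_eq_iff all_7)

lemma vec7_inject [simp]: "vec7 a0 a1 a2 a3 a4 a5 a6 = vec7 b0 b1 b2 b3 b4 b5 b6 \<longleftrightarrow>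
    a0 = b0 \<and> a1 = b1 \<and> a2 = b2 \<and> a3 = b3 \<and> a4 = b4 \<and> a5 = b5 \<and> a6 = b6"
  by (simp add: vec7_eq_iff)

lemma smult_vec7 [simp]:
  "c *s vec7 a0 a1 a2 a3 a4 a5 a6 = vec7 (c * a0) (c * a1) (c * a2) (c * a3) (c * a4) (c * a5) (c * a6)"
  by (simp add: vec7_eq_iff)

lemma vec7_eta: "x = vec7 (x$0) (x$1) (x$2) (x$3) (x$4) (x$5) (x$6)"
  by (simp add: vec7_eq_iff)

lemma zero_vec7: "0 = vec7 0 0 0 0 0 0 0"
  by (simp add: vec7_eq_iff)

lemma matrix_vector_mult_mat: "mat c *v x = c *s (x :: 'a::comm_semiring_1^'n)"
  by (simp add: vec_eq_iff matrix_vector_mult_def mat_def if_distrib if_distribR cong: if_cong)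

lemma matrix_vector_scalar_commute: "A *v (c *s x) = c *s (A *v x :: 'a::comm_semiring_1^'m)"
  by (simp add: vec_eq_iff matrix_vector_mult_def sum_distrib_left mult.left_commute)

lemma matrix_vector_mult_axis: "A *v axis k 1 = column k (A :: 'a::comm_semiring_1^'n^'m)"
  by (simp add: vec_eq_iff matrix_vector_mult_def column_def axis_def if_distrib if_distribR cong: if_cong)

lemma matrix_left_inverse_imp_right_inverse:
  fixes A B :: "'a::{comm_semiring_1,finite}^'n^'n"
  assumes "B ** A = mat 1"
  shows "A ** B = mat 1"
proof -
  have "inj ((*v) A)"
    by (rule inj_on_inverseI [where g = "(*v) B"]) (simp add: matrix_vector_mul_assoc assms)
  then have "surj ((*v) A)"
    using finite_UNIV_inj_surj [OF _ \<open>inj ((*v) A)\<close>] by simp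
  have "(A ** B) *v y = y" for y
  proof -
    obtain x where "y = A *v x"
      using \<open>surj ((*v) A)\<close> by blast
    then show ?thesis
      by (simp add: matrix_vector_mul_assoc matrix_mul_assoc [symmetric] assms)
  qed
  then show ?thesis
    by (simp add: matrix_eq)
qed

lemma invertible_matrix_inv:
  assumes "invertible A"
  shows "A ** matrix_inv A = mat 1" and "matrix_inv A ** A = mat 1"
  using someI_ex [OF assms [unfolded invertible_def]] by (simp_all add: matrix_inv_def)

lemma conjugate_matrix_column:
  fixes A g M :: "'a::comm_semiring_1^'n^'n"
  assumes "g ** M = A ** g"
  shows "A *v column c g = (\<Sum>i\<in>UNIV. M$i$c *s column i g)"
proof -
  have "(A *v column c g) $ r = (\<Sum>i\<in>UNIV. M$i$c *s column i g) $ r" for r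
  proof -
    have "(A *v column c g) $ r = (A ** g) $ r $ c"
      by (simp add: matrix_matrix_mult_def matrix_vector_mult_def column_def)
    also have "\<dots> = (g ** M) $ r $ c"
      by (simp add: assms)
    finally show ?thesis
      by (simp add: sum_component matrix_matrix_mult_def column_def mult.commute)
  qed
  then show ?thesis
    by (simp add: vec_eq_iff)
qed

lemma ix_simps: "ix (Suc 0) = 0" "ix 2 = 1" "ix 3 = 2" "ix 4 = 3" "ix 5 = 4" "ix 6 = 5" "ix 7 = 6"
  by (simp_all add: ix_def)

lemma bform_coords:
  "bform x y = x$0*y$6 + x$1*y$5 + x$2*y$4 + x$3*y$3 + x$4*y$2 + x$5*y$1 + x$6*y$0"
proof -
  have "{1..7::nat} = {1, 2, 3, 4, 5, 6, 7}" by auto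
  then show ?thesis by (simp add: bform_def ix_simps add.assoc)
qed

lemma bform_sum: "bform x y = (\<Sum>k\<in>UNIV. x$k * y$(6 - k))"
  by (simp add: bform_coords sum_UNIV_7 add.assoc)

lemma bform_add_left: "bform (x + y) z = bform x z + bform y z"
  and bform_add_right: "bform z (x + y) = bform z x + bform z y"
  and bform_smult_left: "bform (c *s x) z = c * bform x z"
  and bform_smult_right: "bform z (c *s x) = c * bform z x"
  and bform_zero_left: "bform 0 z = 0"
  by (simp_all add: bform_coords algebra_simps)

lemmas bform_bilinear = bform_add_left bform_add_right bform_smult_left bform_smult_right

lemma bform_axis_left: "bform (axis c 1) y = y $ (6 - c)"
  by (simp add: bform_sum axis_def if_distrib if_distribR cong: if_cong)

lemma bform_axis: "bform (axis c 1) (axis d 1) = (if c + d = 6 then 1 else 0)"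
proof -
  have "6 - c = d \<longleftrightarrow> c + d = 6"
    by (metis diff_add_cancel add_diff_cancel_left')
  then show ?thesis
    unfolding bform_axis_left by (simp add: axis_def)
qed

lemma O7_column_bform:
  assumes "g \<in> O7"
  shows "bform (column c g) (column d g) = (if c + d = 6 then 1 else 0)"
  using assms by (simp add: O7_def bform_axis flip: matrix_vector_mult_axis)

lemma O7_invertible:
  assumes "g \<in> O7"
  shows "invertible g"
proof -
  \<comment> \<open>\<open>L = J g\<^sup>T J\<close>, where \<open>J\<close> is the Gram matrix of \<open>bform\<close>\<close>
  define L where "L = (\<chi> i j. g $ (6 - j) $ (6 - i))"
  have "(L ** g) $ i $ j = bform (column j g) (column (6 - i) g)" for i j
    by (simp add: L_def matrix_matrix_mult_def bform_sum column_def mult.commute)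
  then have "L ** g = mat 1"
    by (simp add: O7_column_bform [OF assms] vec_eq_iff mat_def algebra_simps)
  then show ?thesis
    unfolding invertible_def using matrix_left_inverse_imp_right_inverse by blast
qed

lemma matA_entries: "matA $ i $ j =
    (if (i, j) \<in> {(0,2),(0,5),(1,0),(1,6),(2,1),(4,1),(4,6),(5,2),(5,4),(6,5)} then 1 else 0)"
proof -
  have "(\<exists>a b. (a, b) \<in> A_nonzero \<and> i = ix a \<and> j = ix b) \<longleftrightarrow>
      (i, j) \<in> (\<lambda>(a, b). (ix a, ix b)) ` A_nonzero"
    by auto
  also have "(\<lambda>(a, b). (ix a, ix b)) ` A_nonzero =
      {(0,2),(0,5),(1,0),(1,6),(2,1),(4,1),(4,6),(5,2),(5,4),(6,5)}"
    by (simp add: A_nonzero_def ix_simps)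
  finally show ?thesis
    unfolding matA_def by simp
qed

lemma matA_mult_coords:
  "matA *v x = vec7 (x$2 + x$5) (x$0 + x$6) (x$1) 0 (x$1 + x$6) (x$2 + x$4) (x$5)"
  by (simp add: vec7_eq_iff matrix_vector_mult_def sum_UNIV_7 matA_entries)

definition matA_centralizer :: "(3^7^7) set" where
  "matA_centralizer = {h \<in> O7. \<forall>x. h *v (matA *v x) = matA *v (h *v x)}"

lemma matA_centralizer_mult:
  assumes "g \<in> matA_centralizer" and "h \<in> matA_centralizer"
  shows "g ** h \<in> matA_centralizer"
  using assms by (simp add: matA_centralizer_def O7_def flip: matrix_vector_mul_assoc)

lemma mat_matA_centralizer:
  assumes "c * c = 1"
  shows "mat c \<in> matA_centralizer"
  using assms by (simp add: matA_centralizer_def O7_def matrix_vector_mult_mat matrix_vector_scalar_commute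
      bform_smult_left bform_smult_right mult.assoc [symmetric])

(* Found by a computer search among the solutions h of h A = A h and h^T J h = J. *)
definition swap_matrix :: "3^7^7" where
  "swap_matrix = vec7 (vec7 0 0 0 0 1 0 0) (vec7 0 0 0 0 0 1 0) (vec7 0 0 0 0 0 0 1) (vec7 0 0 0 1 0 0 0)
     (vec7 1 0 0 0 0 0 0) (vec7 0 1 0 0 0 0 0) (vec7 0 0 1 0 0 0 0)"

definition twist_matrix :: "3^7^7" where
  "twist_matrix = vec7 (vec7 1 0 0 0 0 0 0) (vec7 1 0 0 0 1 2 0) (vec7 2 1 1 0 2 1 0) (vec7 0 0 0 1 0 0 0)
     (vec7 0 0 0 0 1 0 0) (vec7 1 2 0 0 1 0 0) (vec7 2 1 0 0 2 1 1)"

lemma swap_matrix_mult: "swap_matrix *v x = vec7 (x$4) (x$5) (x$6) (x$3) (x$0) (x$1) (x$2)"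
  by (simp add: swap_matrix_def vec7_eq_iff matrix_vector_mult_def sum_UNIV_7)

lemma twist_matrix_mult: "twist_matrix *v x = vec7 (x$0) (x$0 + x$4 + 2*x$5) (2*x$0 + x$1 + x$2 + 2*x$4 + x$5)
    (x$3) (x$4) (x$0 + 2*x$1 + x$4) (2*x$0 + x$1 + 2*x$4 + x$5 + x$6)"
  by (simp add: twist_matrix_def vec7_eq_iff matrix_vector_mult_def sum_UNIV_7)

lemma swap_matA_centralizer: "swap_matrix \<in> matA_centralizer"
  by (simp add: matA_centralizer_def O7_def bform_coords matA_mult_coords swap_matrix_mult algebra_simps)

lemma twist_matA_centralizer: "twist_matrix \<in> matA_centralizer"
  by (simp add: matA_centralizer_def O7_def bform_coords matA_mult_coords twist_matrix_mult
      algebra_simps F3_multiples_of_3)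

abbreviation e0 :: "3^7" where
  "e0 \<equiv> vec7 1 0 0 0 0 0 0"

definition matA_isotropic_chain :: "3^7 \<Rightarrow> bool" where
  "matA_isotropic_chain x \<longleftrightarrow> bform x x = 0 \<and> bform x (matA *v x) = 0 \<and>
     bform (matA *v x) (matA *v x) = 0 \<and> bform (matA *v x) (matA *v (matA *v x)) = 0"

lemma matA_isotropic_chain_cases:
  assumes "x \<noteq> 0" and "matA_isotropic_chain x"
  shows "x \<in> {e0, vec7 2 0 0 0 0 0 0, vec7 0 0 0 0 1 0 0, vec7 0 0 0 0 2 0 0,
    vec7 1 1 2 0 0 1 2, vec7 2 2 1 0 0 2 1, vec7 0 1 2 0 1 1 2, vec7 0 2 1 0 2 2 1}"
proof -
  obtain x0 x1 x2 x3 x4 x5 x6 where x: "x = vec7 x0 x1 x2 x3 x4 x5 x6"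
    using vec7_eta [of x] by blast
  show ?thesis
    using assms
    unfolding x matA_isotropic_chain_def bform_coords matA_mult_coords vec7_nth zero_vec7 vec7_inject
      insert_iff empty_iff
    by (elim conjE)
      (cases x0 rule: F3_cases; (simp only: F3_arith)?; cases x1 rule: F3_cases; (simp only: F3_arith)?;
       cases x2 rule: F3_cases; (simp only: F3_arith)?; cases x4 rule: F3_cases; (simp only: F3_arith)?;
       cases x5 rule: F3_cases; (simp only: F3_arith)?; cases x6 rule: F3_cases; (simp only: F3_arith)?;
       cases x3 rule: F3_cases; simp only: F3_arith simp_thms)
qed

lemma matA_isotropic_chain_orbit:
  assumes "x \<noteq> 0" and "matA_isotropic_chain x"
  shows "\<exists>h\<in>matA_centralizer. x = h *v e0"
proof -
  let ?S = "{mat 1, mat 2, swap_matrix, mat 2 ** swap_matrix, twist_matrix, mat 2 ** twist_matrix,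
    swap_matrix ** twist_matrix, mat 2 ** (swap_matrix ** twist_matrix)}"
  have "?S \<subseteq> matA_centralizer"
    by (simp add: mat_matA_centralizer swap_matA_centralizer twist_matA_centralizer matA_centralizer_mult)
  moreover have "(\<lambda>h. h *v e0) ` ?S =
    {e0, vec7 2 0 0 0 0 0 0, vec7 0 0 0 0 1 0 0, vec7 0 0 0 0 2 0 0,
     vec7 1 1 2 0 0 1 2, vec7 2 2 1 0 0 2 1, vec7 0 1 2 0 1 1 2, vec7 0 2 1 0 2 2 1}"
    by (simp add: matrix_vector_mult_mat swap_matrix_mult twist_matrix_mult F3_table
        flip: matrix_vector_mul_assoc)
  ultimately show ?thesis
    using matA_isotropic_chain_cases [OF assms] by blast
qed

lemma matA_orthogonal_isotropic_e0:
  assumes "bform e0 y = 0" and "bform (matA *v e0) y = 0"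
    and "bform (matA *v (matA *v e0)) y = 0" and "bform y y = 0"
  shows "y = y$0 *s e0 + y$1 *s (matA *v e0)"
proof -
  have "y$6 = 0" "y$5 = 0" "y$4 = - y$2"
    using assms(1-3) by (simp_all add: bform_coords matA_mult_coords add_eq_0_iff2)
  moreover from this assms(4) have "y$3 * y$3 = 2 * (y$2 * y$2)"
    by (simp add: bform_coords algebra_simps)
  then have "y$2 = 0" "y$3 = 0"
    by (rule F3_two_nonsquare)+
  ultimately show ?thesis
    by (simp add: vec_eq_iff all_7 matA_mult_coords)
qed

lemma matA_orthogonal_isotropic_span:
  assumes "x \<noteq> 0" and "matA_isotropic_chain x"
    and "bform x y = 0" and "bform (matA *v x) y = 0" and "bform (matA *v (matA *v x)) y = 0"
    and "bform y y = 0"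
  shows "\<exists>c d. y = c *s x + d *s (matA *v x)"
proof -
  obtain h where h: "h \<in> matA_centralizer" and x: "x = h *v e0"
    using matA_isotropic_chain_orbit [OF assms(1,2)] by blast
  have preserves: "bform (h *v u) (h *v v) = bform u v" for u v
    using h by (simp add: matA_centralizer_def O7_def)
  have commutes: "h *v (matA *v u) = matA *v (h *v u)" for u
    using h by (simp add: matA_centralizer_def)
  have "h ** matrix_inv h = mat 1"
    using h by (simp add: matA_centralizer_def O7_invertible invertible_matrix_inv)
  define z where "z = matrix_inv h *v y"
  have y: "y = h *v z"
    by (simp add: z_def matrix_vector_mul_assoc \<open>h ** matrix_inv h = mat 1\<close>)
  have "z = z$0 *s e0 + z$1 *s (matA *v e0)"
    using assms(3-6) unfolding x y
    by (intro matA_orthogonal_isotropic_e0) (simp_all add: preserves flip: commutes)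
  then have "y = z$0 *s x + z$1 *s (matA *v x)"
    unfolding x y by (metis commutes matrix_vector_right_distrib matrix_vector_scalar_commute)
  then show ?thesis
    by blast
qed

lemma no_matA_adapted_hyperbolic_basis:
  fixes b :: "7 \<Rightarrow> 3^7"
  assumes hyperbolic: "\<And>c d. bform (b c) (b d) = (if c + d = 6 then 1 else 0)"
    and A_b0: "matA *v b 0 = p0 *s b 0 + p1 *s b 1"
    and A_b1: "matA *v b 1 = q0 *s b 0 + q1 *s b 1 + q2 *s b 2 + q3 *s b 3"
  shows False
proof -
  note expand = A_b0 A_b1 matrix_vector_right_distrib matrix_vector_scalar_commute bform_bilinear hyperbolic
  have "b 0 \<noteq> 0"
    using hyperbolic [of 0 6] by (auto simp: bform_zero_left)
  moreover have "matA_isotropic_chain (b 0)"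
    by (simp add: matA_isotropic_chain_def expand)
  moreover have "bform (b 0) (b 2) = 0" "bform (matA *v b 0) (b 2) = 0"
    "bform (matA *v (matA *v b 0)) (b 2) = 0" "bform (b 2) (b 2) = 0"
    by (simp_all add: expand)
  ultimately obtain c d where "b 2 = c *s b 0 + d *s (matA *v b 0)"
    using matA_orthogonal_isotropic_span by blast
  then have "bform (b 2) (b 4) = 0"
    by (simp add: expand)
  with hyperbolic [of 2 4] show False
    by simp
qed

theorem lemma2p2:
  shows "\<not> (\<exists>g \<in> O7. \<forall>(i, j) \<in> zero_pos. (matrix_inv g ** matA ** g) $ ix i $ ix j = 0)"
proof
  assume "\<exists>g \<in> O7. \<forall>(i, j) \<in> zero_pos. (matrix_inv g ** matA ** g) $ ix i $ ix j = 0"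
  then obtain g where g: "g \<in> O7"
    and zeros: "\<forall>(i, j) \<in> zero_pos. (matrix_inv g ** matA ** g) $ ix i $ ix j = 0"
    by blast
  define M where "M = matrix_inv g ** matA ** g"
  have "g ** M = matA ** g"
    using invertible_matrix_inv(1) [OF O7_invertible [OF g]] by (simp add: M_def matrix_mul_assoc)
  then have A_column: "matA *v column c g = (\<Sum>i\<in>UNIV. M$i$c *s column i g)" for c
    by (rule conjugate_matrix_column)
  have "M$2$0 = 0" "M$3$0 = 0" "M$4$0 = 0" "M$5$0 = 0" "M$6$0 = 0" "M$4$1 = 0" "M$5$1 = 0" "M$6$1 = 0"
    using zeros by (simp_all add: zero_pos_def M_def ix_simps)
  with A_column [of 0] A_column [of 1] show False
    using no_matA_adapted_hyperbolic_basis [of "\<lambda>c. column c g" "M$0$0" "M$1$0" "M$0$1" "M$1$1" "M$2$1" "M$3$1"]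
      O7_column_bform [OF g] by (simp add: sum_UNIV_7)
qed

end
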